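(* Let $G$ be a compactly generated locally compact group, let $H$ be a closed normal subgroup of $G$ of finite index $r$, and let $x_1,\dots,x_r$ be coset representatives, so that $G=x_1H\cup\dots\cup x_rH$. Let $\Phi=\{\varphi_1,\dots,\varphi_r\}$, where each $\varphi_i:H\to G$ is a continuous surjective homomorphism, and assume that: (1) $\bigcap_{i=1}^r\ker(\varphi_i)\neq 1$; (2) for every $i,j\in\{1,\dots,r\}$ there exists $k\in\{1,\dots,r\}$ such that $\varphi_i\circ\mu_{x_j}=\varphi_k$, where $\mu_{x_j}:H\to H$ is the automorphism of $H$ induced by conjugation by $x_j$, $\mu_{x_j}(h)=x_jhx_j^{-1}$; (3) the image of the homomorphism $H\to G^r$, $h\mapsto(\varphi_1(h),\dots,\varphi_r(h))$, contains the diagonal of $G^r$. Define $K_0=1$ and $K_{n+1}=\bigcap_{i=1}^r\varphi_i^{-1}(K_n)$ for $n\ge 0$, and $K_\Phi=\bigcup_{n\ge 0}K_n$, and assume that $K_\Phi$ is closed in $G$. Then the group $G_\Phi=G/K_\Phi$ is densely related.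
   Context: Under the hypotheses, $(K_n)$ is an increasing sequence of normal subgroups of $G$ (contained in $H$), so $K_\Phi$ is a normal subgroup of $G$ and $G_\Phi$ is a compactly generated locally compact group. For a group $G$ with a generating subset $S$, let $F_S$ be the free group on $S$ with its word length, let $N$ be the kernel of the natural map $F_S\to G$, and for $n\ge 0$ let $N_n$ be the normal subgroup of $F_S$ generated (as a normal subgroup) by the elements of $N$ of length at most $n$ ($N_{-1}$ is trivial). The relation range $\mathcal{R}_S(G)$ is the set of integers $n\ge 0$ such that $N_n$ properly contains $N_{n-1}$. A compactly generated locally compact group $G$ is densely related if, for a compact generating subset $S$, there exists $c>0$ such that for all integers $n\ge 1$ we have $\mathcal{R}_S(G)\cap[n,cn]\neq\emptyset$ (this does not depend on the compact generating subset $S$). *)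

theory Defs
  imports "HOL-Analysis.Analysis" "HOL-Algebra.Coset" "HOL-Algebra.Generated_Groups"
begin

section \<open>Topological groups\<close>

locale topological_group = group G for G (structure) +
  fixes T :: "'a topology"
  assumes topspace_eq: "topspace T = carrier G"
    and continuous_mult: "continuous_map (prod_topology T T) T (\<lambda>(x, y). x \<otimes> y)"
    and continuous_inv: "continuous_map T T (\<lambda>x. inv x)"

text \<open>Locally compact groups are Hausdorff, as usual.\<close>

locale locally_compact_group = topological_group +
  assumes Hausdorff: "Hausdorff_space T"
    and locally_compact: "locally_compact_space T"

definition compact_generating_set ::
    "('a, 'b) monoid_scheme \<Rightarrow> 'a topology \<Rightarrow> 'a set \<Rightarrow> bool" where
  "compact_generating_set G T S \<longleftrightarrow> compactin T S \<and> generate G S = carrier G"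

definition compactly_generated :: "('a, 'b) monoid_scheme \<Rightarrow> 'a topology \<Rightarrow> bool" where
  "compactly_generated G T \<longleftrightarrow> (\<exists>S. compact_generating_set G T S)"

definition quotient_group_topology ::
    "('a, 'b) monoid_scheme \<Rightarrow> 'a topology \<Rightarrow> 'a set \<Rightarrow> 'a set topology" where
  "quotient_group_topology G T K = topology (\<lambda>U. U \<subseteq> carrier (G Mod K) \<and>
     openin T {x \<in> carrier G. K #>\<^bsub>G\<^esub> x \<in> U})"

lemma openin_quotient_group_topology:
  "openin (quotient_group_topology G T K) U \<longleftrightarrow>
     U \<subseteq> carrier (G Mod K) \<and> openin T {x \<in> carrier G. K #>\<^bsub>G\<^esub> x \<in> U}"
proof -
  let ?P = "\<lambda>U. U \<subseteq> carrier (G Mod K) \<and> openin T {x \<in> carrier G. K #>\<^bsub>G\<^esub> x \<in> U}"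
  have "istopology ?P"
    unfolding istopology_def
  proof (intro conjI allI impI)
    fix A B assume A: "?P A" and B: "?P B"
    have "{x \<in> carrier G. K #>\<^bsub>G\<^esub> x \<in> A \<inter> B} =
        {x \<in> carrier G. K #>\<^bsub>G\<^esub> x \<in> A} \<inter> {x \<in> carrier G. K #>\<^bsub>G\<^esub> x \<in> B}" by auto
    then show "openin T {x \<in> carrier G. K #>\<^bsub>G\<^esub> x \<in> A \<inter> B}"
      using A B by (simp add: openin_Int)
    show "A \<inter> B \<subseteq> carrier (G Mod K)" using A by blast
  next
    fix \<U> assume U: "\<forall>U\<in>\<U>. ?P U"
    have "{x \<in> carrier G. K #>\<^bsub>G\<^esub> x \<in> \<Union>\<U>} = (\<Union>U\<in>\<U>. {x \<in> carrier G. K #>\<^bsub>G\<^esub> x \<in> U})"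
      by auto
    then show "openin T {x \<in> carrier G. K #>\<^bsub>G\<^esub> x \<in> \<Union>\<U>}"
      using U by (auto intro!: openin_Union)
    show "\<Union>\<U> \<subseteq> carrier (G Mod K)" using U by blast
  qed
  then show ?thesis
    by (simp add: quotient_group_topology_def topology_inverse')
qed

lemma quotient_map_quotient_group_topology:
  assumes "topspace T = carrier G"
  shows "quotient_map T (quotient_group_topology G T K) (\<lambda>x. K #>\<^bsub>G\<^esub> x)"
proof -
  have "{x \<in> carrier G. K #>\<^bsub>G\<^esub> x \<in> carrier (G Mod K)} = topspace T"
    using assms by (auto simp: FactGroup_def RCOSETS_def)
  then have "openin (quotient_group_topology G T K) (carrier (G Mod K))"
    by (simp add: openin_quotient_group_topology)
  then have top: "topspace (quotient_group_topology G T K) = carrier (G Mod K)"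
    using openin_topspace[of "quotient_group_topology G T K"]
    by (intro subset_antisym openin_subset) (auto simp only: openin_quotient_group_topology)
  show ?thesis
    unfolding quotient_map_def top openin_quotient_group_topology assms
    by (auto simp: FactGroup_def RCOSETS_def)
qed


section \<open>Free groups\<close>

text \<open>
  The letter \<^term>\<open>(False, s)\<close> stands for \<^term>\<open>s\<close> and \<^term>\<open>(True, s)\<close> for its formal inverse.
  Elements of the free group are the reduced words, so the word length of an element is
  the length of the list.
\<close>

type_synonym 'a word = "(bool \<times> 'a) list"

definition letter_inv :: "bool \<times> 'a \<Rightarrow> bool \<times> 'a" where
  "letter_inv a = (\<not> fst a, snd a)"

definition reduced_word :: "'a word \<Rightarrow> bool" where
  "reduced_word w \<longleftrightarrow> successively (\<lambda>a b. b \<noteq> letter_inv a) w"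

fun cons_reduce :: "bool \<times> 'a \<Rightarrow> 'a word \<Rightarrow> 'a word" where
  "cons_reduce a [] = [a]"
| "cons_reduce a (b # w) = (if b = letter_inv a then w else a # b # w)"

definition free_group :: "'a set \<Rightarrow> 'a word monoid" where
  "free_group S =
     \<lparr>carrier = {w. snd ` set w \<subseteq> S \<and> reduced_word w},
      mult = (\<lambda>u v. foldr cons_reduce u v),
      one = []\<rparr>"

definition eval_word :: "('a, 'b) monoid_scheme \<Rightarrow> 'a word \<Rightarrow> 'a" where
  "eval_word G w = foldr (\<lambda>a g. (if fst a then inv\<^bsub>G\<^esub> (snd a) else snd a) \<otimes>\<^bsub>G\<^esub> g) w \<one>\<^bsub>G\<^esub>"

lemma letter_inv_letter_inv [simp]: "letter_inv (letter_inv a) = a"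
  by (simp add: letter_inv_def)

lemma snd_letter_inv [simp]: "snd (letter_inv a) = snd a"
  by (simp add: letter_inv_def)

lemma reduced_Cons: "reduced_word (a # w) \<longleftrightarrow> reduced_word w \<and> (w = [] \<or> hd w \<noteq> letter_inv a)"
  by (cases w) (auto simp: reduced_word_def)

lemma reduced_Nil [simp]: "reduced_word []"
  by (simp add: reduced_word_def)

lemma reduced_cons_reduce: "reduced_word w \<Longrightarrow> reduced_word (cons_reduce a w)"
  by (cases w) (auto simp: reduced_Cons)

lemma cons_reduce_cancel: "reduced_word w \<Longrightarrow> cons_reduce a (cons_reduce (letter_inv a) w) = w"
  by (cases w; cases "tl w") (auto simp: reduced_Cons)

lemma cons_reduce_reduced: "reduced_word (a # w) \<Longrightarrow> cons_reduce a w = a # w"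
  by (cases w) (auto simp: reduced_Cons)

lemma reduced_foldr: "reduced_word v \<Longrightarrow> reduced_word (foldr cons_reduce u v)"
  by (induction u) (auto intro: reduced_cons_reduce)

lemma set_cons_reduce: "snd ` set (cons_reduce a w) \<subseteq> insert (snd a) (snd ` set w)"
  by (cases w) auto

lemma set_foldr: "snd ` set (foldr cons_reduce u v) \<subseteq> snd ` set u \<union> snd ` set v"
proof (induction u)
  case (Cons a u)
  have "snd ` set (foldr cons_reduce (a # u) v) \<subseteq>
      insert (snd a) (snd ` set (foldr cons_reduce u v))"
    using set_cons_reduce[of a "foldr cons_reduce u v"] by simp
  also have "\<dots> \<subseteq> insert (snd a) (snd ` set u \<union> snd ` set v)"
    using Cons.IH by (rule insert_mono)
  finally show ?case by simp
qed simp

lemma foldr_cons_reduce: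
  assumes "reduced_word v"
  shows "foldr cons_reduce (cons_reduce a u) v = cons_reduce a (foldr cons_reduce u v)"
proof (cases u)
  case (Cons b u')
  then show ?thesis
    using cons_reduce_cancel[OF reduced_foldr[OF assms, of u'], of a] by auto
qed simp

lemma foldr_assoc:
  assumes "reduced_word w"
  shows "foldr cons_reduce (foldr cons_reduce u v) w = foldr cons_reduce u (foldr cons_reduce v w)"
  by (induction u) (simp_all add: foldr_cons_reduce assms)

lemma foldr_Nil: "reduced_word w \<Longrightarrow> foldr cons_reduce w [] = w"
  by (induction w) (auto simp: cons_reduce_reduced reduced_Cons)

lemma foldr_inverse:
  assumes "reduced_word v"
  shows "foldr cons_reduce (rev (map letter_inv u)) (foldr cons_reduce u v) = v"
  using assms
proof (induction u arbitrary: v)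
  case (Cons a u)
  have "cons_reduce (letter_inv a) (cons_reduce a w) = w" if "reduced_word w" for w
    using cons_reduce_cancel[OF that, of "letter_inv a"] by simp
  then show ?case using Cons by (simp add: reduced_foldr)
qed simp

theorem group_free_group: "group (free_group S)"
proof (rule groupI)
  fix u v assume "u \<in> carrier (free_group S)" "v \<in> carrier (free_group S)"
  then show "u \<otimes>\<^bsub>free_group S\<^esub> v \<in> carrier (free_group S)"
    using subset_trans[OF set_foldr[of u v], of S] by (simp add: free_group_def reduced_foldr)
next
  fix u assume u: "u \<in> carrier (free_group S)"
  let ?v = "foldr cons_reduce (rev (map letter_inv u)) []"
  have "?v \<in> carrier (free_group S)"
    using u subset_trans[OF set_foldr[of "rev (map letter_inv u)" "[]"], of S]
    by (simp add: free_group_def reduced_foldr image_image)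
  moreover have "?v \<otimes>\<^bsub>free_group S\<^esub> u = \<one>\<^bsub>free_group S\<^esub>"
    using u foldr_inverse[of "[]" u] foldr_assoc[of u "rev (map letter_inv u)" "[]"]
    by (simp add: free_group_def foldr_Nil)
  ultimately show "\<exists>v\<in>carrier (free_group S). v \<otimes>\<^bsub>free_group S\<^esub> u = \<one>\<^bsub>free_group S\<^esub>"
    by blast
qed (auto simp: free_group_def foldr_assoc)

theorem (in group) eval_word_hom:
  assumes "S \<subseteq> carrier G"
  shows "eval_word G \<in> hom (free_group S) G"
proof -
  have closed: "eval_word G w \<in> carrier G" if "snd ` set w \<subseteq> S" for w
    using that assms by (induction w) (auto simp: eval_word_def)
  have push: "eval_word G (cons_reduce a w) =
      (if fst a then inv (snd a) else snd a) \<otimes> eval_word G w"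
    if "snd a \<in> S" "snd ` set w \<subseteq> S" for a w
  proof (cases w)
    case Nil
    then show ?thesis by (simp add: eval_word_def)
  next
    case (Cons b u)
    have [simp]: "snd a \<in> carrier G" using that assms by blast
    have eu: "eval_word G u \<in> carrier G" using closed that Cons by simp
    have "inv (snd a) \<otimes> (snd a \<otimes> eval_word G u) = eval_word G u"
      and "snd a \<otimes> (inv (snd a) \<otimes> eval_word G u) = eval_word G u"
      using eu by (simp_all add: m_assoc [symmetric])
    then show ?thesis using Cons by (simp add: eval_word_def letter_inv_def)
  qed
  have mult: "eval_word G (foldr cons_reduce u v) = eval_word G u \<otimes> eval_word G v"
    if "snd ` set u \<subseteq> S" "snd ` set v \<subseteq> S" for u v
    using that
  proof (induction u)
    case Nil
    then show ?case using closed by (simp add: eval_word_def)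
  next
    case (Cons a u)
    have a: "(if fst a then inv (snd a) else snd a) \<in> carrier G"
      using Cons.prems assms by auto
    have "snd ` set (foldr cons_reduce u v) \<subseteq> S"
      using subset_trans[OF set_foldr[of u v], of S] Cons.prems by simp
    then have "eval_word G (foldr cons_reduce (a # u) v) =
        (if fst a then inv (snd a) else snd a) \<otimes> (eval_word G u \<otimes> eval_word G v)"
      using push Cons by simp
    also have "\<dots> = (if fst a then inv (snd a) else snd a) \<otimes> eval_word G u \<otimes> eval_word G v"
      using a closed Cons.prems by (simp add: m_assoc)
    also have "\<dots> = eval_word G (a # u) \<otimes> eval_word G v"
      by (simp add: eval_word_def)
    finally show ?case .
  qed
  show ?thesis
    using closed mult by (auto simp: hom_def free_group_def)
qed


section \<open>Relation range and densely related groups\<close>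

definition normal_closure :: "('a, 'b) monoid_scheme \<Rightarrow> 'a set \<Rightarrow> 'a set" where
  "normal_closure G A = \<Inter>{N. N \<lhd> G \<and> A \<subseteq> N}"

text \<open>The bound is an integer so that \<open>relators_upto G S (-1)\<close> is the trivial subgroup.\<close>

definition relators_upto :: "('a, 'b) monoid_scheme \<Rightarrow> 'a set \<Rightarrow> int \<Rightarrow> 'a word set" where
  "relators_upto G S n = normal_closure (free_group S)
     {w \<in> kernel (free_group S) G (eval_word G). int (length w) \<le> n}"

definition relation_range :: "('a, 'b) monoid_scheme \<Rightarrow> 'a set \<Rightarrow> nat set" where
  "relation_range G S = {n. relators_upto G S (int n - 1) \<subset> relators_upto G S (int n)}"

text \<open>The choice of the compact generating subset is immaterial for the condition below.\<close>

definition densely_related :: "('a, 'b) monoid_scheme \<Rightarrow> 'a topology \<Rightarrow> bool" where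
  "densely_related G T \<longleftrightarrow> locally_compact_group G T \<and>
     (\<exists>S. compact_generating_set G T S \<and>
       (\<exists>c::real. c > 0 \<and>
         (\<forall>n::nat. n \<ge> 1 \<longrightarrow> (\<exists>m\<in>relation_range G S. real n \<le> real m \<and> real m \<le> c * real n))))"


section \<open>The iterated kernels of a family of virtual homomorphisms\<close>

primrec K_seq ::
    "('a, 'b) monoid_scheme \<Rightarrow> 'a set \<Rightarrow> nat \<Rightarrow> (nat \<Rightarrow> 'a \<Rightarrow> 'a) \<Rightarrow> nat \<Rightarrow> 'a set" where
  "K_seq G H r \<phi> 0 = {\<one>\<^bsub>G\<^esub>}"
| "K_seq G H r \<phi> (Suc n) = (\<Inter>i\<in>{1..r}. {h \<in> H. \<phi> i h \<in> K_seq G H r \<phi> n})"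

definition K_limit ::
    "('a, 'b) monoid_scheme \<Rightarrow> 'a set \<Rightarrow> nat \<Rightarrow> (nat \<Rightarrow> 'a \<Rightarrow> 'a) \<Rightarrow> 'a set" where
  "K_limit G H r \<phi> = (\<Union>n. K_seq G H r \<phi> n)"

end

theory Submission
  imports Defs
begin

text \<open>
  Let \<open>S\<close> be a symmetric compact generating set and \<open>B m\<close> the set of elements of \<open>K = K\<^sub>\<Phi>\<close> of
  length at most \<open>m\<close>. If the relation range of \<open>G / K\<close> missed the interval \<open>(m, n]\<close>, then \<open>B n\<close>
  would lie in the normal closure \<open>M\<close> of \<open>B m\<close> in \<open>G\<close>. Hypothesis (3) and Baire's theorem give a
  constant \<open>L\<close> such that every element of length at most \<open>m\<close> is the common image under all \<open>\<phi>\<^sub>i\<close>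
  of an element of length at most \<open>L m\<close>, so that \<open>B m \<subseteq> \<phi>\<^sub>1 (B (L m))\<close>. Taking \<open>n = L m\<close>, we get
  \<open>B m \<subseteq> \<phi>\<^sub>1 (M)\<close>. By Baire's theorem again, now in the closed subgroup \<open>K\<close>, the compact set
  \<open>B m\<close> lies in some \<open>K\<^sub>j\<close>, hence so does \<open>M\<close>; thus \<open>B m \<subseteq> \<phi>\<^sub>1 (M)\<close> lies in the preceding term of
  the sequence \<open>K\<^sub>j\<close>, and descending in \<open>j\<close> we find \<open>B m\<close> trivial, which by (1) is false for
  large \<open>m\<close>.
\<close>

section \<open>Relations of a quotient group\<close>

text \<open>Products of exactly \<open>n\<close> elements of \<open>S\<close>. Balls in the word
  length arise only because the sets \<open>S\<close> used later contain \<open>\<one>\<close>,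
  which makes the products increase with \<open>n\<close>, and are closed under inverses.\<close>

primrec word_ball :: "('a, 'b) monoid_scheme \<Rightarrow> 'a set \<Rightarrow> nat \<Rightarrow> 'a set" where
  "word_ball G S 0 = {\<one>\<^bsub>G\<^esub>}"
| "word_ball G S (Suc n) = S <#>\<^bsub>G\<^esub> word_ball G S n"

lemma (in monoid) word_ball_subset:
  assumes "S \<subseteq> carrier G"
  shows "word_ball G S n \<subseteq> carrier G"
  using assms by (induction n) (auto simp: set_mult_def)

lemma (in monoid) word_ball_mult:
  assumes "S \<subseteq> carrier G" "g \<in> word_ball G S m" "h \<in> word_ball G S n"
  shows "g \<otimes> h \<in> word_ball G S (m + n)"
  using assms(2)
proof (induction m arbitrary: g)
  case 0
  moreover have "h \<in> carrier G" using assms word_ball_subset by blast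
  ultimately show ?case using assms(3) by simp
next
  case (Suc m)
  then obtain s g' where g: "s \<in> S" "g' \<in> word_ball G S m" "g = s \<otimes> g'"
    by (auto simp: set_mult_def)
  moreover have "s \<in> carrier G" "g' \<in> carrier G" "h \<in> carrier G"
    using g assms word_ball_subset[OF assms(1)] by blast+
  ultimately have "g \<otimes> h = s \<otimes> (g' \<otimes> h)"
    by (simp add: m_assoc)
  then show ?case
    using Suc.IH[OF g(2)] g(1) by (auto simp: set_mult_def)
qed

lemma (in monoid) word_ball_mono:
  assumes "S \<subseteq> carrier G" "\<one> \<in> S" "m \<le> n"
  shows "word_ball G S m \<subseteq> word_ball G S n"
  using assms(3)
proof (induction rule: dec_induct)
  case (step k)
  have "word_ball G S k \<subseteq> word_ball G S (Suc k)"
  proof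
    fix g assume "g \<in> word_ball G S k"
    then have "\<one> \<otimes> g \<in> word_ball G S (Suc k)" "g \<in> carrier G"
      using assms(2) word_ball_subset[OF assms(1), of k] by (auto simp: set_mult_def)
    then show "g \<in> word_ball G S (Suc k)" by simp
  qed
  with step.IH show ?case by (rule subset_trans)
qed simp

lemma (in monoid) word_ball_1: "S \<subseteq> carrier G \<Longrightarrow> word_ball G S 1 = S"
  by (simp add: set_mult_def subset_iff)

lemma (in group) Union_word_ball:
  assumes "generate G S = carrier G" "\<And>s. s \<in> S \<Longrightarrow> inv s \<in> S"
  shows "(\<Union>n. word_ball G S n) = carrier G"
proof -
  have S: "S \<subseteq> carrier G"
    using generate.incl[of _ S G] unfolding assms(1) by (rule subsetI)
  have "g \<in> (\<Union>n. word_ball G S n)" if "g \<in> generate G S" for g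
    using that
  proof induction
    case one
    show ?case by (rule UN_I[of 0]) simp_all
  next
    case (incl h)
    then show ?case using word_ball_1[OF S] by (intro UN_I[of 1]) simp_all
  next
    case (inv h)
    then show ?case using word_ball_1[OF S] assms(2) by (intro UN_I[of 1]) simp_all
  next
    case (eng h1 h2)
    then obtain m n where "h1 \<in> word_ball G S m" "h2 \<in> word_ball G S n" by blast
    then have "h1 \<otimes> h2 \<in> word_ball G S (m + n)" by (rule word_ball_mult[OF S])
    then show ?case by blast
  qed
  then show ?thesis
    using assms(1) word_ball_subset[OF S] by blast
qed

section \<open>Normal closures and preimages of normal subgroups\<close>

lemma normal_closure_subset: "A \<subseteq> normal_closure G A"
  by (auto simp: normal_closure_def)

lemma normal_closure_minimal: "N \<lhd> G \<Longrightarrow> A \<subseteq> N \<Longrightarrow> normal_closure G A \<subseteq> N"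
  by (auto simp: normal_closure_def)

lemma normal_closure_mono: "A \<subseteq> B \<Longrightarrow> normal_closure G A \<subseteq> normal_closure G B"
  by (auto simp: normal_closure_def)

lemma (in group) carrier_normal: "carrier G \<lhd> G"
  by (simp add: normal_inv_iff subgroup_self)

text \<open>The family being intersected is nonempty, as it contains \<open>carrier G\<close>; an
  empty intersection would be the whole type.\<close>

lemma (in group) normal_closure_normal:
  assumes "A \<subseteq> carrier G"
  shows "normal_closure G A \<lhd> G"
proof -
  have "subgroup (normal_closure G A) G"
    unfolding normal_closure_def
    by (rule subgroups_Inter) (use assms carrier_normal normal_imp_subgroup in auto)
  then show ?thesis
    by (auto simp: normal_inv_iff normal_closure_def)
qed

lemma (in group) normal_preimage:
  assumes "group F" "f \<in> hom F G" "M \<lhd> G"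
  shows "{w \<in> carrier F. f w \<in> M} \<lhd> F"
proof -
  interpret F: group F by fact
  interpret f: group_hom F G f by unfold_locales (rule assms)
  interpret M: normal M G by fact
  have "subgroup {w \<in> carrier F. f w \<in> M} F"
    by unfold_locales auto
  moreover have "f (x \<otimes>\<^bsub>F\<^esub> h \<otimes>\<^bsub>F\<^esub> inv\<^bsub>F\<^esub> x) \<in> M" if "x \<in> carrier F" "h \<in> carrier F" "f h \<in> M" for x h
    using that M.inv_op_closed2 by simp
  ultimately show ?thesis
    by (auto simp: F.normal_inv_iff)
qed

text \<open>\<open>eval_word\<close> reads each letter as a group element. Words over a set of
  cosets have to be read in \<open>G\<close> instead, through chosen representatives of the
  letters.\<close>

definition eval_word_via :: "('a, 'b) monoid_scheme \<Rightarrow> ('c \<Rightarrow> 'a) \<Rightarrow> 'c word \<Rightarrow> 'a" where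
  "eval_word_via G f w = eval_word G (map (map_prod id f) w)"

lemma eval_word_via_simps [simp]:
  "eval_word_via G f [] = \<one>\<^bsub>G\<^esub>"
  "eval_word_via G f (a # w) =
     (if fst a then inv\<^bsub>G\<^esub> (f (snd a)) else f (snd a)) \<otimes>\<^bsub>G\<^esub> eval_word_via G f w"
  by (simp_all add: eval_word_via_def eval_word_def)

lemma (in group) eval_word_via_closed:
  assumes "f \<in> A \<rightarrow> carrier G" "snd ` set w \<subseteq> A"
  shows "eval_word_via G f w \<in> carrier G"
  using assms(2) by (induction w) (use assms(1) in auto)

text \<open>Universal property of the free group. If \<open>f\<close> identifies letters,
  relabelling a reduced word can leave it unreduced, so \<open>eval_word_hom\<close> does not apply
  to the relabelled word; \<open>push\<close> checks directly that cancelling a pair of letters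
  leaves the value unchanged.\<close>

lemma (in group) eval_word_via_hom:
  assumes f: "f \<in> A \<rightarrow> carrier G"
  shows "eval_word_via G f \<in> hom (free_group A) G"
proof -
  let ?e = "eval_word_via G f"
  note closed = eval_word_via_closed[OF f]
  have push: "?e (cons_reduce a w) = ?e [a] \<otimes> ?e w" if "snd a \<in> A" "snd ` set w \<subseteq> A" for a w
  proof (cases w)
    case Nil
    have "f (snd a) \<in> carrier G" using that f by blast
    then show ?thesis using Nil by simp
  next
    case (Cons b u)
    have "f (snd a) \<in> carrier G" "?e u \<in> carrier G" using that f Cons closed[of u] by auto
    then have "inv (f (snd a)) \<otimes> (f (snd a) \<otimes> ?e u) = ?e u" "f (snd a) \<otimes> (inv (f (snd a)) \<otimes> ?e u) = ?e u"
      by (simp_all add: m_assoc [symmetric])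
    with \<open>f (snd a) \<in> carrier G\<close> show ?thesis using Cons by (simp add: letter_inv_def)
  qed
  have "?e (foldr cons_reduce u v) = ?e u \<otimes> ?e v" if "snd ` set u \<subseteq> A" "snd ` set v \<subseteq> A" for u v
    using that
  proof (induction u)
    case Nil
    then show ?case using closed by simp
  next
    case (Cons a u)
    have fa: "f (snd a) \<in> carrier G" using Cons.prems f by auto
    have "snd ` set (foldr cons_reduce u v) \<subseteq> A"
      using subset_trans[OF set_foldr[of u v], of A] Cons.prems by simp
    then have "?e (foldr cons_reduce (a # u) v) = ?e [a] \<otimes> (?e u \<otimes> ?e v)"
      using push[of a "foldr cons_reduce u v"] Cons by simp
    also have "\<dots> = ?e (a # u) \<otimes> ?e v"
      using fa closed[of u] closed[of v] Cons.prems by (simp add: m_assoc)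
    finally show ?case .
  qed
  then show ?thesis
    using closed by (auto simp: hom_def free_group_def)
qed

text \<open>The subgroups \<open>relators_upto G S k\<close> increase with \<open>k\<close>, and the
  relation range consists of the places where they jump; along a gap in the range they stay
  constant.\<close>

lemma relators_upto_subset:
  assumes "m \<le> n" "\<And>k. m < k \<Longrightarrow> k \<le> n \<Longrightarrow> k \<notin> relation_range G S"
  shows "relators_upto G S (int n) \<subseteq> relators_upto G S (int m)"
  using assms
proof (induction rule: dec_induct)
  case (step n)
  have "relators_upto G S (int n) \<subseteq> relators_upto G S (int (Suc n))"
    unfolding relators_upto_def by (rule normal_closure_mono) auto
  moreover have "Suc n \<notin> relation_range G S"
    using step by simp
  ultimately have "relators_upto G S (int (Suc n)) = relators_upto G S (int n)"
    by (auto simp: relation_range_def)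
  then show ?case using step by simp
qed simp

text \<open>The free group on the image of \<open>S\<close> has no natural map to \<open>G\<close>: the one induced by a choice
  of lifts becomes canonical only modulo the kernel elements \<open>s\<inverse>t\<close> with \<open>s, t \<in> S\<close>, whence the
  lower bound on \<open>m\<close>.\<close>

lemma (in normal) relation_range_FactGroup:
  assumes S: "S \<subseteq> carrier G" "\<one> \<in> S" "\<And>s. s \<in> S \<Longrightarrow> inv s \<in> S"
    and m: "2 \<le> m" "m \<le> n"
    and not_sub: "\<not> H \<inter> word_ball G S n \<subseteq> normal_closure G (H \<inter> word_ball G S m)"
  shows "\<exists>k\<in>relation_range (G Mod H) ((\<lambda>g. H #> g) ` S). m < k \<and> k \<le> n"
proof (rule ccontr)
  let ?p = "\<lambda>g. H #> g" and ?Q = "G Mod H"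
  let ?A = "?p ` S"
  let ?F = "free_group ?A"
  define M where "M = normal_closure G (H \<inter> word_ball G S m)"
  define \<sigma> where "\<sigma> = inv_into S ?p"
  let ?e = "eval_word_via G \<sigma>"
  interpret M: normal M G
    unfolding M_def by (rule normal_closure_normal) auto
  interpret Q: group ?Q by (rule factorgroup_is_group)
  interpret p: group_hom G ?Q ?p
    by unfold_locales (rule r_coset_hom_Mod)
  have \<sigma>S: "\<sigma> c \<in> S" and p\<sigma>: "?p (\<sigma> c) = c" if "c \<in> ?A" for c
    using that by (simp_all add: \<sigma>_def inv_into_into f_inv_into_f)
  have \<sigma>: "\<sigma> \<in> ?A \<rightarrow> carrier G" using \<sigma>S S(1) by blast
  have A: "?A \<subseteq> carrier ?Q" using S(1) p.hom_closed by blast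
  interpret e: group_hom ?F G ?e
    by (intro group_hom.intro group_free_group is_group group_hom_axioms.intro eval_word_via_hom \<sigma>)
  interpret eQ: group_hom ?F ?Q "eval_word ?Q"
    by (intro group_hom.intro group_free_group Q.is_group group_hom_axioms.intro Q.eval_word_hom A)
  \<comment> \<open>Symmetry of \<open>S\<close> keeps the values of inverse letters in
    \<open>S\<close>, so each letter costs exactly one factor.\<close>
  have word: "?e w \<in> word_ball G S (length w) \<and> ?p (?e w) = eval_word ?Q w"
    if "snd ` set w \<subseteq> ?A" for w
    using that
  proof (induction w)
    case Nil
    then show ?case using p.hom_one by (simp add: eval_word_def)
  next
    case (Cons a w)
    then have a: "snd a \<in> ?A" "\<sigma> (snd a) \<in> carrier G" using \<sigma> by auto
    let ?s = "if fst a then inv (\<sigma> (snd a)) else \<sigma> (snd a)"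
    have s: "?s \<in> S" "?s \<in> carrier G" "?p ?s = (if fst a then inv\<^bsub>?Q\<^esub> (snd a) else snd a)"
      using a \<sigma>S S(3) p\<sigma> by (auto simp: p.hom_inv simp del: mult_FactGroup)
    moreover have "?e w \<in> carrier G" using eval_word_via_closed[OF \<sigma>] Cons.prems by simp
    ultimately have "?p (?s \<otimes> ?e w) = ?p ?s \<otimes>\<^bsub>?Q\<^esub> ?p (?e w)"
      using p.hom_mult by blast
    with s Cons show ?case
      by (auto simp: set_mult_def eval_word_def simp del: mult_FactGroup)
  qed
  \<comment> \<open>A relator of length at most \<open>m\<close> takes, through the lifts, a value
    in \<open>H\<close> of length at most \<open>m\<close>, hence in \<open>M\<close>. Being normal,
    \<open>?P\<close> then contains the whole normal closure of these relators.\<close>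
  let ?P = "{w \<in> carrier ?F. ?e w \<in> M}"
  have "relators_upto ?Q ?A (int m) \<subseteq> ?P"
    unfolding relators_upto_def
  proof (rule normal_closure_minimal)
    show "?P \<lhd> ?F"
      by (intro normal_preimage group_free_group e.homh M.normal_axioms)
    show "{w \<in> kernel ?F ?Q (eval_word ?Q). int (length w) \<le> int m} \<subseteq> ?P"
    proof clarify
      fix w assume w: "w \<in> kernel ?F ?Q (eval_word ?Q)" "int (length w) \<le> int m"
      then have wF: "w \<in> carrier ?F" and "eval_word ?Q w = H" by (auto simp: kernel_def)
      moreover from wF have "snd ` set w \<subseteq> ?A" by (simp add: free_group_def)
      ultimately have "?e w \<in> word_ball G S (length w)" "?p (?e w) = H" "?e w \<in> carrier G"
        using word[of w] by auto
      then have "?e w \<in> H \<inter> word_ball G S m"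
        using word_ball_mono[OF S(1,2), of "length w" m] w(2) coset_join1 subgroup_axioms by auto
      then show "w \<in> carrier ?F \<and> ?e w \<in> M"
        using wF normal_closure_subset[of "H \<inter> word_ball G S m" G] by (auto simp: M_def)
    qed
  qed
  then have relP: "w \<in> ?P" if "w \<in> relators_upto ?Q ?A (int m)" for w
    using that by blast
  \<comment> \<open>The word found represents \<open>g\<close> modulo \<open>M\<close>, not merely
    modulo \<open>H\<close>. It is built letter by letter, each \<open>s\<close> being replaced by
    the chosen representative \<open>?t\<close> of its coset.\<close>
  have lift: "\<exists>w\<in>carrier ?F. length w \<le> k \<and> eval_word ?Q w = ?p g \<and> inv g \<otimes> ?e w \<in> M"
    if "g \<in> word_ball G S k" for g k
    using that
  proof (induction k arbitrary: g)
    case 0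
    have "[] \<in> carrier ?F" by (simp add: free_group_def)
    with 0 show ?case using p.hom_one by (intro bexI[of _ "[]"]) (auto simp: eval_word_def)
  next
    case (Suc k)
    then obtain s h where s: "s \<in> S" and h: "h \<in> word_ball G S k" and g: "g = s \<otimes> h"
      by (auto simp: set_mult_def)
    obtain w where w: "w \<in> carrier ?F" "length w \<le> k" "eval_word ?Q w = ?p h" "inv h \<otimes> ?e w \<in> M"
      using Suc.IH[OF h] by blast
    have car [simp]: "s \<in> carrier G" "h \<in> carrier G" "?e w \<in> carrier G"
      using s h S(1) word_ball_subset[OF S(1)] w by auto
    let ?l = "[(False, ?p s)]" and ?t = "\<sigma> (?p s)"
    have t: "?t \<in> S" "?p ?t = ?p s" using s \<sigma>S p\<sigma> by auto
    then have [simp]: "?t \<in> carrier G" using S(1) by blast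
    have l: "?l \<in> carrier ?F" using s by (simp add: free_group_def reduced_word_def)
    have "length (cons_reduce (False, ?p s) w) \<le> Suc (length w)" by (cases w) auto
    then have len: "length (?l \<otimes>\<^bsub>?F\<^esub> w) \<le> Suc k" using w(2) by (simp add: free_group_def)
    have eQl: "eval_word ?Q ?l = ?p s"
      using Q.r_one[OF p.hom_closed[OF car(1)]]
      by (simp only: eval_word_def list.simps foldr.simps o_apply id_apply fst_conv snd_conv if_False)
    have "eval_word ?Q (?l \<otimes>\<^bsub>?F\<^esub> w) = ?p g"
      unfolding g eQ.hom_mult[OF l w(1)] eQl w(3) by (rule p.hom_mult[symmetric]) simp_all
    moreover have "inv g \<otimes> ?e (?l \<otimes>\<^bsub>?F\<^esub> w) \<in> M"
    proof -
      have "?p (inv s \<otimes> ?t) = \<one>\<^bsub>?Q\<^esub>"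
        using p.hom_mult[of "inv s" ?t] p.hom_mult[of "inv s" s] p.hom_one by (simp add: t(2))
      then have "inv s \<otimes> ?t \<in> H"
        using coset_join1[OF _ _ subgroup_axioms] by simp
      moreover have "inv s \<otimes> ?t \<in> word_ball G S (1 + 1)"
        using word_ball_mult[OF S(1), of "inv s" 1 ?t 1] s t S(3) word_ball_1[OF S(1)] by simp
      ultimately have "inv s \<otimes> ?t \<in> M"
        using normal_closure_subset[of "H \<inter> word_ball G S m" G] word_ball_mono[OF S(1,2), of "1 + 1" m] m(1)
        unfolding M_def by auto
      \<comment> \<open>The error \<open>inv s \<otimes> ?t\<close> lies in \<open>H\<close> and has
        length at most 2, so it is in \<open>M\<close> because \<open>2 \<le> m\<close>. Its
        conjugate by \<open>h\<close> times the error inherited from \<open>h\<close> telescopes to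
        the new error.\<close>
      then have "(inv h \<otimes> (inv s \<otimes> ?t) \<otimes> h) \<otimes> (inv h \<otimes> ?e w) \<in> M"
        using M.inv_op_closed1[of h] w(4) by simp
      moreover have "h \<otimes> (inv h \<otimes> ?e w) = ?e w"
        by (simp flip: m_assoc)
      then have "(inv h \<otimes> (inv s \<otimes> ?t) \<otimes> h) \<otimes> (inv h \<otimes> ?e w) = inv g \<otimes> (?t \<otimes> ?e w)"
        by (simp add: g inv_mult_group m_assoc)
      moreover have "?e (?l \<otimes>\<^bsub>?F\<^esub> w) = ?t \<otimes> ?e w"
        using e.hom_mult[OF l w(1)] by simp
      ultimately show ?thesis by simp
    qed
    ultimately show ?case using len l w(1) by blast
  qed
  assume "\<not> ?thesis"
  then have le: "relators_upto ?Q ?A (int n) \<subseteq> relators_upto ?Q ?A (int m)"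
    using m(2) by (intro relators_upto_subset) auto
  \<comment> \<open>A word for such a \<open>g\<close> is a relator of length at most
    \<open>n\<close>, so by the gap it lies in \<open>relators_upto ?Q ?A (int m)\<close> and its
    value through the lifts lies in \<open>M\<close>. That value agrees with \<open>g\<close> modulo
    \<open>M\<close>, forcing \<open>g \<in> M\<close>.\<close>
  obtain g where g: "g \<in> H" "g \<in> word_ball G S n" "g \<notin> M"
    using not_sub by (auto simp: M_def)
  obtain w where w: "w \<in> carrier ?F" "length w \<le> n" "eval_word ?Q w = ?p g" "inv g \<otimes> ?e w \<in> M"
    using lift[OF g(2)] by blast
  have "w \<in> relators_upto ?Q ?A (int n)"
  proof -
    have "?p g = H" using g(1) rcos_const is_group by blast
    then have "w \<in> kernel ?F ?Q (eval_word ?Q)" using w by (simp add: kernel_def)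
    with w(2) show ?thesis
      unfolding relators_upto_def by (intro subsetD[OF normal_closure_subset]) simp
  qed
  then have "?e w \<in> M" using relP[OF subsetD[OF le]] by simp
  then have "?e w \<otimes> inv (inv g \<otimes> ?e w) \<in> M"
    using w(4) by simp
  moreover have "?e w \<otimes> inv (inv g \<otimes> ?e w) = g"
    using g(1) w(1) by (simp add: inv_mult_group flip: m_assoc)
  ultimately show False
    using g(3) by simp
qed

section \<open>Topological groups\<close>

context topological_group
begin

lemma continuous_map_binary:
  assumes "continuous_map X T f" "continuous_map X T g"
  shows "continuous_map X T (\<lambda>z. f z \<otimes> g z)"
  using continuous_map_compose[OF continuous_map_pairedI[OF assms] continuous_mult]
  by (simp add: o_def)

lemma continuous_map_left_mult: "a \<in> carrier G \<Longrightarrow> continuous_map T T (\<lambda>z. a \<otimes> z)"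
  by (rule continuous_map_binary) (simp_all add: topspace_eq)

lemma openin_l_coset:
  assumes "openin T U" "a \<in> carrier G"
  shows "openin T (a <# U)"
proof -
  have U: "U \<subseteq> carrier G" using openin_subset[OF assms(1)] topspace_eq by simp
  have "a <# U = {z \<in> topspace T. inv a \<otimes> z \<in> U}"
  proof (intro subset_antisym subsetI)
    fix z assume "z \<in> a <# U"
    then obtain u where "u \<in> U" "z = a \<otimes> u" by (auto simp: l_coset_def)
    with U assms(2) show "z \<in> {z \<in> topspace T. inv a \<otimes> z \<in> U}"
      by (auto simp: topspace_eq subset_iff simp flip: m_assoc)
  next
    fix z assume z: "z \<in> {z \<in> topspace T. inv a \<otimes> z \<in> U}"
    then have "a \<otimes> (inv a \<otimes> z) = z"
      using assms(2) by (simp add: topspace_eq flip: m_assoc)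
    with z show "z \<in> a <# U" by (force simp: l_coset_def)
  qed
  then show ?thesis
    using openin_continuous_map_preimage[OF continuous_map_left_mult assms(1), of "inv a"] assms(2)
    by simp
qed

lemma compactin_set_mult:
  assumes "compactin T A" "compactin T B"
  shows "compactin T (A <#> B)"
proof -
  have "compactin (prod_topology T T) (A \<times> B)"
    using assms by (simp add: compactin_Times)
  moreover have "A <#> B = (\<lambda>(x, y). x \<otimes> y) ` (A \<times> B)"
    by (auto simp: set_mult_def)
  ultimately show ?thesis
    using image_compactin[OF _ continuous_mult] by simp
qed

lemma compactin_word_ball: "compactin T S \<Longrightarrow> compactin T (word_ball G S n)"
  by (induction n) (auto simp: compactin_set_mult topspace_eq)

lemma symmetric_compact_generating_set:
  assumes "compactly_generated G T"
  obtains S where "compact_generating_set G T S" "\<one> \<in> S" "\<And>s. s \<in> S \<Longrightarrow> inv s \<in> S"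
proof -
  obtain S where S: "compactin T S" "generate G S = carrier G"
    using assms by (auto simp: compactly_generated_def compact_generating_set_def)
  have sub: "S \<subseteq> carrier G" using compactin_subset_topspace[OF S(1)] topspace_eq by simp
  let ?S = "insert \<one> (S \<union> (\<lambda>s. inv s) ` S)"
  have "compactin T (insert \<one> S \<union> (\<lambda>s. inv s) ` S)"
    by (intro compactin_Un image_compactin[OF S(1) continuous_inv])
       (use S(1) compactin_Un[of T "{\<one>}" S] in \<open>auto simp: topspace_eq\<close>)
  moreover have sub': "?S \<subseteq> carrier G" using sub by auto
  moreover have "generate G ?S = carrier G"
    using mono_generate[of S ?S] S(2) generate_incl[OF sub'] by blast
  ultimately have "compact_generating_set G T ?S"
    by (simp add: compact_generating_set_def)
  moreover have "inv s \<in> ?S" if "s \<in> ?S" for s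
    using that sub by (auto simp: subset_iff)
  ultimately show ?thesis using that by blast
qed

end

section \<open>Baire category in closed subgroups\<close>

context locally_compact_group
begin

text \<open>The closed subgroup \<open>C\<close> is locally compact Hausdorff, so Baire's theorem
  gives some \<open>A m\<close> an interior point in \<open>C\<close>. Finitely many translates of
  that interior cover \<open>Q\<close>, and \<open>A_mult\<close> absorbs the translations. The
  additive form of \<open>A_mult\<close> suits both images of word balls and an increasing sequence
  of subgroups.\<close>

lemma compactin_subset_exhaustion:
  assumes C: "subgroup C G" "closedin T C"
    and A: "\<And>n. closedin T (A n)" "(\<Union>n. A n) = C" "incseq A"
    and A_mult: "\<And>m n g h. g \<in> A m \<Longrightarrow> h \<in> A n \<Longrightarrow> g \<otimes> h \<in> A (m + n)"
    and Q: "compactin T Q" "Q \<subseteq> C"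
  shows "\<exists>n. Q \<subseteq> A n"
proof -
  interpret C: subgroup C G by fact
  let ?X = "subtopology T C"
  have X: "topspace ?X = C" using C.subset topspace_eq by auto
  have "\<exists>n. ?X interior_of A n \<noteq> {}"
  proof (rule ccontr)
    assume "\<not> ?thesis"
    moreover have "locally_compact_space ?X" "regular_space ?X"
      using locally_compact_space_closed_subset[OF locally_compact C(2)]
        Hausdorff_space_subtopology[OF Hausdorff] locally_compact_Hausdorff_imp_regular_space by blast+
    moreover have "closedin ?X (A n)" for n
      using A(1,2) closedin_subset_topspace by blast
    ultimately have "?X interior_of \<Union>(range A) = {}"
      by (intro Baire_category_alt) auto
    then have "C = {}"
      using A(2) X interior_of_topspace[of ?X] by metis
    then show False
      using C.one_closed by blast
  qed
  then obtain m o' where o': "o' \<in> ?X interior_of A m" by blast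
  then obtain U where U: "openin T U" "?X interior_of A m = U \<inter> C"
    by (metis openin_interior_of openin_subtopology)
  have "U \<inter> C \<subseteq> A m" using U(2) interior_of_subset by metis
  have oC: "o' \<in> C" "o' \<in> U" using o' U(2) by auto
  \<comment> \<open>Translation by \<open>q \<otimes> inv o'\<close> carries \<open>o'\<close> to
    \<open>q\<close>, so the sets \<open>?V q\<close> cover \<open>Q\<close>.\<close>
  let ?V = "\<lambda>q. (q \<otimes> inv o') <# U"
  have "\<exists>\<F>. finite \<F> \<and> \<F> \<subseteq> ?V ` Q \<and> Q \<subseteq> \<Union>\<F>"
  proof -
    have "openin T (?V q) \<and> q \<in> ?V q" if "q \<in> Q" for q
    proof -
      have q: "q \<in> carrier G" "o' \<in> carrier G" using that Q(2) oC C.subset by auto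
      then have "q = q \<otimes> inv o' \<otimes> o'" by (simp add: m_assoc)
      with oC have "q \<in> ?V q" by (auto simp: l_coset_def)
      with q show ?thesis by (simp add: openin_l_coset[OF U(1)])
    qed
    then have "Ball (?V ` Q) (openin T)" "Q \<subseteq> \<Union>(?V ` Q)" by auto
    with Q(1) show ?thesis unfolding compactin_def by blast
  qed
  then obtain \<F> where \<F>: "finite \<F>" "\<F> \<subseteq> ?V ` Q" "Q \<subseteq> \<Union>\<F>" by blast
  obtain Q' where "Q' \<subseteq> Q" "finite Q'" "\<F> = ?V ` Q'"
    using finite_subset_image[OF \<F>(1,2)] by blast
  with \<F>(3) have Q': "finite Q'" "Q' \<subseteq> Q" "Q \<subseteq> (\<Union>q\<in>Q'. ?V q)" by simp_all
  have "\<exists>k. q \<otimes> inv o' \<in> A k" if "q \<in> Q'" for q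
  proof -
    have "q \<in> C" using that Q'(2) Q(2) by blast
    then have "q \<otimes> inv o' \<in> (\<Union>n. A n)" using oC A(2) by simp
    then show ?thesis by blast
  qed
  then obtain k where k: "\<And>q. q \<in> Q' \<Longrightarrow> q \<otimes> inv o' \<in> A (k q)" by metis
  \<comment> \<open>The \<open>0\<close> keeps the maximum meaningful when \<open>Q'\<close> is
    empty.\<close>
  define N where "N = Max (insert 0 (k ` Q'))"
  have "Q \<subseteq> A (N + m)"
  proof
    fix g assume g: "g \<in> Q"
    then obtain q u where q: "q \<in> Q'" and u: "u \<in> U" and gu: "g = q \<otimes> inv o' \<otimes> u"
      using Q'(3) by (auto simp: l_coset_def)
    \<comment> \<open>The open set \<open>U\<close> may leave \<open>C\<close>, but \<open>u\<close>
      does not: both \<open>g\<close> and the translating element lie in \<open>C\<close>.\<close>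
    have "q \<otimes> inv o' \<in> C" using q Q' Q(2) oC by blast
    moreover have "u \<in> carrier G" using u openin_subset[OF U(1)] topspace_eq by auto
    ultimately have "u = inv (q \<otimes> inv o') \<otimes> g" using gu by (simp add: C.mem_carrier flip: m_assoc)
    then have "u \<in> C" using \<open>q \<otimes> inv o' \<in> C\<close> g Q(2) by auto
    then have "u \<in> A m" using u \<open>U \<inter> C \<subseteq> A m\<close> by blast
    moreover have "k q \<le> N" using q Q'(1) by (simp add: N_def)
    then have "q \<otimes> inv o' \<in> A N" using k[OF q] A(3) by (auto simp: incseq_def)
    ultimately show "g \<in> A (N + m)" using A_mult gu by blast
  qed
  then show ?thesis by blast
qed

text \<open>An open mapping theorem in disguise: the lifts are found in a \<open>\<sigma>\<close>-compact closed
  subgroup, and Baire's theorem bounds their length.\<close>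

lemma bounded_lifts:
  assumes S: "compact_generating_set G T S" "\<one> \<in> S" "\<And>s. s \<in> S \<Longrightarrow> inv s \<in> S"
    and D: "subgroup D G" "closedin T D"
    and f: "f \<in> hom (G\<lparr>carrier := D\<rparr>) G" "continuous_map (subtopology T D) T f" "f ` D = carrier G"
  shows "\<exists>L. \<forall>m. word_ball G S m \<subseteq> f ` (D \<inter> word_ball G S (L * m))"
proof -
  interpret D: subgroup D G by fact
  have SG: "S \<subseteq> carrier G" "compactin T S" "generate G S = carrier G"
    using S(1) topspace_eq compactin_subset_topspace by (auto simp: compact_generating_set_def)
  have f_mult: "f (g \<otimes> h) = f g \<otimes> f h" if "g \<in> D" "h \<in> D" for g h
    using f(1) that by (auto simp: hom_def)
  define A where "A n = f ` (D \<inter> word_ball G S n)" for n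
  have A_mult: "g \<otimes> h \<in> A (m + n)" if "g \<in> A m" "h \<in> A n" for m n g h
  proof -
    obtain g' h' where g': "g' \<in> D" "g' \<in> word_ball G S m" "g = f g'"
      and h': "h' \<in> D" "h' \<in> word_ball G S n" "h = f h'"
      using \<open>g \<in> A m\<close> \<open>h \<in> A n\<close> unfolding A_def by blast
    then have "g' \<otimes> h' \<in> D \<inter> word_ball G S (m + n)" "g \<otimes> h = f (g' \<otimes> h')"
      using word_ball_mult[OF SG(1)] f_mult by auto
    then show ?thesis unfolding A_def by blast
  qed
  \<comment> \<open>The exhaustion lemma is applied in \<open>G\<close> itself: the sets
    \<open>A n\<close> are compact, hence closed, and they cover \<open>G\<close> because
    \<open>f\<close> is onto.\<close>
  have "\<exists>L. S \<subseteq> A L"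
  proof (rule compactin_subset_exhaustion)
    show "subgroup (carrier G) G" by (rule subgroup_self)
    show "closedin T (carrier G)" using topspace_eq closedin_topspace by metis
    show "closedin T (A n)" for n
    proof -
      have "compactin T (D \<inter> word_ball G S n)"
        using closed_Int_compactin[OF D(2) compactin_word_ball[OF SG(2)]] .
      then have "compactin T (A n)"
        unfolding A_def by (intro image_compactin[OF _ f(2)]) (simp add: compactin_subtopology)
      then show ?thesis using compactin_imp_closedin[OF Hausdorff] by blast
    qed
    have "(\<Union>n. A n) = f ` (D \<inter> (\<Union>n. word_ball G S n))" by (auto simp: A_def)
    also have "\<dots> = carrier G"
      using Union_word_ball[OF SG(3) S(3)] f(3) D.subset by (simp add: Int_absorb2)
    finally show "(\<Union>n. A n) = carrier G" .
    show "incseq A"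
      unfolding incseq_def A_def using word_ball_mono[OF SG(1) S(2)] by (intro allI impI image_mono) blast
  qed (use A_mult SG in auto)
  then obtain L where L: "S \<subseteq> A L" by blast
  \<comment> \<open>Products are lifted factor by factor at cost \<open>L\<close> each, so the bound
    is linear in \<open>m\<close>.\<close>
  have "word_ball G S m \<subseteq> A (L * m)" for m
  proof (induction m)
    case 0
    have "f \<one> \<otimes> f \<one> = f \<one>" "f \<one> \<in> carrier G"
      using f_mult[of \<one> \<one>] f(3) D.one_closed by auto
    then have "f \<one> = \<one>" using l_cancel_one[of "f \<one>" "f \<one>"] by simp
    then show ?case using D.one_closed by (force simp: A_def)
  next
    case (Suc m)
    show ?case
    proof
      fix g assume "g \<in> word_ball G S (Suc m)"
      then obtain s h where "s \<in> S" "h \<in> word_ball G S m" "g = s \<otimes> h" by (auto simp: set_mult_def)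
      then show "g \<in> A (L * Suc m)" using Suc.IH L A_mult[of s L h "L * m"] by auto
    qed
  qed
  then show ?thesis unfolding A_def by blast
qed

section \<open>Quotients by closed normal subgroups\<close>

lemma locally_compact_group_quotient:
  assumes "K \<lhd> G" "closedin T K"
  shows "locally_compact_group (G Mod K) (quotient_group_topology G T K)"
proof -
  interpret K: normal K G by fact
  let ?Q = "G Mod K" and ?R = "quotient_group_topology G T K" and ?p = "\<lambda>g. K #> g"
  interpret Q: group ?Q by (rule K.factorgroup_is_group)
  interpret p: group_hom G ?Q ?p by unfold_locales (rule K.r_coset_hom_Mod)
  have quot: "quotient_map T ?R ?p"
    by (rule quotient_map_quotient_group_topology[OF topspace_eq])
  have p_eq: "?p g = ?p h \<longleftrightarrow> g \<otimes> inv h \<in> K" if "g \<in> carrier G" "h \<in> carrier G" for g h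
  proof
    assume "?p g = ?p h"
    then have "g \<in> ?p h" using rcos_self[OF that(1) K.subgroup_axioms] by simp
    then show "g \<otimes> inv h \<in> K" using K.rcos_module_imp[OF is_group that(2)] by blast
  next
    assume "g \<otimes> inv h \<in> K"
    then have "g \<in> ?p h" using K.rcos_module_rev[OF is_group that(2,1)] by blast
    then show "?p g = ?p h" using repr_independence[OF _ that(2) K.subgroup_axioms] by simp
  qed
  have top: "topspace ?R = carrier ?Q"
    using quotient_imp_surjective_map[OF quot] topspace_eq by (auto simp: carrier_FactGroup)
  \<comment> \<open>The saturation of an open set \<open>U\<close> is the union of its translates by
    elements of \<open>K\<close>.\<close>
  have open_p: "open_map T ?R ?p"
    unfolding open_map_def
  proof (intro allI impI)
    fix U assume U: "openin T U"
    then have UG: "U \<subseteq> carrier G" using openin_subset topspace_eq by metis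
    have "{g \<in> carrier G. ?p g \<in> ?p ` U} = (\<Union>k\<in>K. k <# U)"
    proof (intro subset_antisym subsetI)
      fix g assume "g \<in> {g \<in> carrier G. ?p g \<in> ?p ` U}"
      then obtain u where "g \<in> carrier G" "u \<in> U" "?p g = ?p u" by blast
      moreover from this have "g \<otimes> inv u \<in> K" "g \<otimes> inv u \<otimes> u = g"
        using p_eq UG by (auto simp: m_assoc subset_iff)
      ultimately show "g \<in> (\<Union>k\<in>K. k <# U)" by (force simp: l_coset_def)
    next
      fix g assume "g \<in> (\<Union>k\<in>K. k <# U)"
      then obtain k u where k: "k \<in> K" "u \<in> U" "g = k \<otimes> u" by (auto simp: l_coset_def)
      then have gu: "g \<in> carrier G" "u \<in> carrier G" "g \<otimes> inv u = k"
        using UG by (auto simp: m_assoc subset_iff K.mem_carrier)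
      then have "?p g = ?p u" using p_eq[OF gu(1,2)] k(1) by metis
      with gu(1) k(2) show "g \<in> {g \<in> carrier G. ?p g \<in> ?p ` U}" by blast
    qed
    moreover have "openin T (\<Union>k\<in>K. k <# U)"
      using openin_l_coset[OF U] K.mem_carrier by blast
    ultimately show "openin ?R (?p ` U)"
      using UG p.hom_closed by (auto simp: openin_quotient_group_topology)
  qed
  have cont_p: "continuous_map T ?R ?p"
    using quot by (rule quotient_imp_continuous_map)
  let ?pp = "\<lambda>(g, h). (?p g, ?p h)"
  \<comment> \<open>A product of quotient maps can fail to be a quotient map. Openness of the
    projection rescues this, and multiplication then descends.\<close>
  have "open_map (prod_topology T T) (prod_topology ?R ?R) ?pp"
    unfolding open_map_def
  proof (intro allI impI)
    fix W assume W: "openin (prod_topology T T) W"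
    show "openin (prod_topology ?R ?R) (?pp ` W)"
      unfolding openin_prod_topology_alt
    proof (intro allI impI)
      fix c d assume "(c, d) \<in> ?pp ` W"
      then obtain g h where gh: "(g, h) \<in> W" "c = ?p g" "d = ?p h" by auto
      obtain U V where UV: "openin T U" "openin T V" "g \<in> U" "h \<in> V" "U \<times> V \<subseteq> W"
        using W[unfolded openin_prod_topology_alt, rule_format, OF gh(1)] by blast
      have "?p ` U \<times> ?p ` V \<subseteq> ?pp ` W"
        unfolding image_paired_Times[symmetric] using UV(5) by (rule image_mono)
      moreover have "openin ?R (?p ` U)" "openin ?R (?p ` V)"
        using open_p UV(1,2) by (auto simp: open_map_def)
      moreover have "c \<in> ?p ` U" "d \<in> ?p ` V"
        using gh(2,3) UV(3,4) by simp_all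
      ultimately show "\<exists>U V. openin ?R U \<and> openin ?R V \<and> c \<in> U \<and> d \<in> V \<and> U \<times> V \<subseteq> ?pp ` W"
        by (intro exI conjI)
    qed
  qed
  moreover have "continuous_map (prod_topology T T) (prod_topology ?R ?R) ?pp"
    using cont_p by (simp add: continuous_map_prod_top)
  moreover have "?pp ` topspace (prod_topology T T) = topspace (prod_topology ?R ?R)"
    unfolding topspace_prod_topology image_paired_Times quotient_imp_surjective_map[OF quot] ..
  ultimately have quot2: "quotient_map (prod_topology T T) (prod_topology ?R ?R) ?pp"
    by (intro continuous_open_imp_quotient_map)
  show ?thesis
  proof (unfold_locales)
    show "topspace ?R = carrier ?Q" by (rule top)
    have "continuous_map (prod_topology T T) ?R (?p \<circ> (\<lambda>(g, h). g \<otimes> h))"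
      using continuous_mult cont_p by (rule continuous_map_compose)
    then have "continuous_map (prod_topology T T) ?R ((\<lambda>(c, d). c \<otimes>\<^bsub>?Q\<^esub> d) \<circ> ?pp)"
      by (rule continuous_map_eq) (auto simp: topspace_eq simp del: mult_FactGroup)
    then show "continuous_map (prod_topology ?R ?R) ?R (\<lambda>(c, d). c \<otimes>\<^bsub>?Q\<^esub> d)"
      by (rule continuous_compose_quotient_map[OF quot2])
    have "continuous_map T ?R (?p \<circ> (\<lambda>g. inv g))"
      using continuous_inv cont_p by (rule continuous_map_compose)
    then have "continuous_map T ?R ((\<lambda>c. inv\<^bsub>?Q\<^esub> c) \<circ> ?p)"
      by (rule continuous_map_eq) (auto simp: topspace_eq p.hom_inv)
    then show "continuous_map ?R ?R (\<lambda>c. inv\<^bsub>?Q\<^esub> c)"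
      by (rule continuous_compose_quotient_map[OF quot])
    show "locally_compact_space ?R"
      using locally_compact_space_continuous_open_map_image[OF cont_p open_p
          quotient_imp_surjective_map[OF quot] locally_compact] .
    show "Hausdorff_space ?R"
      unfolding Hausdorff_space_def
    proof (intro allI impI)
      fix c d assume cd: "c \<in> topspace ?R \<and> d \<in> topspace ?R \<and> c \<noteq> d"
      then obtain g h where gh: "g \<in> carrier G" "h \<in> carrier G" "c = ?p g" "d = ?p h"
        using top by (auto simp: carrier_FactGroup)
      \<comment> \<open>Since \<open>K\<close> is closed, the pairs with \<open>?f z\<close> outside
        \<open>K\<close> form an open set; an open box in it projects to disjoint
        neighbourhoods.\<close>
      let ?f = "\<lambda>z. fst z \<otimes> inv (snd z)"
      let ?W = "{z \<in> topspace (prod_topology T T). ?f z \<in> topspace T - K}"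
      have "continuous_map (prod_topology T T) T ?f"
        by (intro continuous_map_binary continuous_map_fst
            continuous_map_compose[OF continuous_map_snd continuous_inv, unfolded o_def])
      then have "openin (prod_topology T T) ?W"
        using assms(2) openin_continuous_map_preimage by blast
      moreover have "(g, h) \<in> ?W" using gh cd p_eq by (simp add: topspace_eq)
      ultimately obtain U V where UV: "openin T U" "openin T V" "g \<in> U" "h \<in> V" "U \<times> V \<subseteq> ?W"
        unfolding openin_prod_topology_alt by meson
      have "disjnt (?p ` U) (?p ` V)"
      proof -
        have "?p u \<noteq> ?p v" if "u \<in> U" "v \<in> V" for u v
        proof -
          have "(u, v) \<in> ?W" using that UV(5) by blast
          then show ?thesis using p_eq by (simp add: topspace_eq)
        qed
        then show ?thesis unfolding disjnt_def by blast
      qed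
      moreover have "openin ?R (?p ` U)" "openin ?R (?p ` V)"
        using open_p UV(1,2) by (auto simp: open_map_def)
      moreover have "c \<in> ?p ` U" "d \<in> ?p ` V"
        using gh(3,4) UV(3,4) by simp_all
      ultimately show "\<exists>U V. openin ?R U \<and> openin ?R V \<and> c \<in> U \<and> d \<in> V \<and> disjnt U V"
        by (intro exI conjI)
    qed
  qed
qed

lemma compact_generating_set_quotient:
  assumes "K \<lhd> G" "compact_generating_set G T S"
  shows "compact_generating_set (G Mod K) (quotient_group_topology G T K) ((\<lambda>g. K #> g) ` S)"
proof -
  interpret K: normal K G by fact
  interpret p: group_hom G "G Mod K" "\<lambda>g. K #> g"
    by (intro group_hom.intro is_group K.factorgroup_is_group group_hom_axioms.intro K.r_coset_hom_Mod)
  have S: "compactin T S" "S \<subseteq> carrier G" "generate G S = carrier G"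
    using assms(2) compactin_subset_topspace topspace_eq by (auto simp: compact_generating_set_def)
  have "compactin (quotient_group_topology G T K) ((\<lambda>g. K #> g) ` S)"
    using image_compactin[OF S(1)] quotient_imp_continuous_map
      quotient_map_quotient_group_topology[OF topspace_eq] by blast
  moreover have "generate (G Mod K) ((\<lambda>g. K #> g) ` S) = carrier (G Mod K)"
    using p.generate_img[OF S(2)] S(3) by (simp add: carrier_FactGroup)
  ultimately show ?thesis by (simp add: compact_generating_set_def)
qed

end

section \<open>The iterated kernels\<close>

text \<open>The algebraic part of the setting, in which normality of the iterated kernels and the
  descent along them take place.\<close>

locale finite_index_epimorphisms = normal H G for H and G (structure) +
  fixes r :: nat and x :: "nat \<Rightarrow> 'a" and \<phi> :: "nat \<Rightarrow> 'a \<Rightarrow> 'a"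
  assumes r_pos: "1 \<le> r"
    and representatives: "\<And>i. i \<in> {1..r} \<Longrightarrow> x i \<in> carrier G"
    and cosets: "carrier G = (\<Union>i\<in>{1..r}. x i <# H)"
    and \<phi>_epi: "\<And>i. i \<in> {1..r} \<Longrightarrow> \<phi> i \<in> epi (G\<lparr>carrier := H\<rparr>) G"
    and \<phi>_conj: "\<forall>i\<in>{1..r}. \<forall>j\<in>{1..r}. \<exists>k\<in>{1..r}. \<forall>h\<in>H. \<phi> i (x j \<otimes> h \<otimes> inv (x j)) = \<phi> k h"
begin

abbreviation K where "K \<equiv> K_seq G H r \<phi>"

lemma \<phi>_hom:
  assumes "i \<in> {1..r}"
  shows "group_hom (G\<lparr>carrier := H\<rparr>) G (\<phi> i)"
  using \<phi>_epi[OF assms] subgroup.subgroup_is_group[OF subgroup_axioms is_group]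
  by (intro group_hom.intro group_hom_axioms.intro is_group) (auto simp: epi_def)

lemma \<phi>_closed: "i \<in> {1..r} \<Longrightarrow> h \<in> H \<Longrightarrow> \<phi> i h \<in> carrier G"
  using group_hom.hom_closed[OF \<phi>_hom, of i h] by simp

lemma \<phi>_mult: "i \<in> {1..r} \<Longrightarrow> g \<in> H \<Longrightarrow> h \<in> H \<Longrightarrow> \<phi> i (g \<otimes> h) = \<phi> i g \<otimes> \<phi> i h"
  using group_hom.hom_mult[OF \<phi>_hom, of i g h] by simp

lemma \<phi>_one: "i \<in> {1..r} \<Longrightarrow> \<phi> i \<one> = \<one>"
  using group_hom.hom_one[OF \<phi>_hom, of i] by simp

lemma \<phi>_inv: "i \<in> {1..r} \<Longrightarrow> h \<in> H \<Longrightarrow> \<phi> i (inv h) = inv (\<phi> i h)"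
  using group_hom.hom_inv[OF \<phi>_hom, of i h] m_inv_consistent[OF subgroup_axioms, of h] by simp

text \<open>For \<open>r = 0\<close> the intersection defining \<open>K (Suc n)\<close> would be the
  whole type; hence \<open>r_pos\<close>.\<close>

lemma K_Suc: "h \<in> K (Suc n) \<longleftrightarrow> h \<in> H \<and> (\<forall>i\<in>{1..r}. \<phi> i h \<in> K n)"
  using r_pos by auto

text \<open>Write a conjugating element as \<open>x j \<otimes> h'\<close> with
  \<open>h' \<in> H\<close>. Conjugation by \<open>x j\<close> turns \<open>\<phi> i\<close> into
  some \<open>\<phi> k\<close>, and conjugation by \<open>h'\<close> becomes conjugation by
  \<open>\<phi> k h'\<close>, under which \<open>K n\<close> is invariant by induction.\<close>

lemma K_normal: "K n \<lhd> G"
proof (induction n)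
  case 0
  show ?case by (auto simp: normal_inv_iff intro: triv_subgroup)
next
  case (Suc n)
  interpret N: normal "K n" G by (rule Suc.IH)
  have "subgroup (K (Suc n)) G"
  proof (rule subgroupI)
    show "K (Suc n) \<subseteq> carrier G" using K_Suc subset by blast
    show "K (Suc n) \<noteq> {}"
      using K_Suc[of \<one> n] \<phi>_one by (metis N.one_closed empty_iff subgroup.one_closed[OF subgroup_axioms])
  next
    fix g assume "g \<in> K (Suc n)"
    then show "inv g \<in> K (Suc n)"
      unfolding K_Suc using \<phi>_inv by simp
  next
    fix g h assume "g \<in> K (Suc n)" "h \<in> K (Suc n)"
    then show "g \<otimes> h \<in> K (Suc n)"
      unfolding K_Suc using \<phi>_mult by simp
  qed
  moreover have "g \<otimes> h \<otimes> inv g \<in> K (Suc n)" if g: "g \<in> carrier G" and h: "h \<in> K (Suc n)" for g h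
    unfolding K_Suc
  proof (intro conjI ballI)
    have hH: "h \<in> H" "h \<in> carrier G" using h K_Suc subset by blast+
    show "g \<otimes> h \<otimes> inv g \<in> H" using inv_op_closed2[OF g hH(1)] .
    fix i assume i: "i \<in> {1..r}"
    obtain j h' where j: "j \<in> {1..r}" and h': "h' \<in> H" and g_eq: "g = x j \<otimes> h'"
      using g cosets by (auto simp: l_coset_def)
    obtain k where k: "k \<in> {1..r}" "\<And>h. h \<in> H \<Longrightarrow> \<phi> i (x j \<otimes> h \<otimes> inv (x j)) = \<phi> k h"
      using \<phi>_conj i j by blast
    have "x j \<in> carrier G" "h' \<in> carrier G" using representatives[OF j] h' subset by auto
    then have "g \<otimes> h \<otimes> inv g = x j \<otimes> (h' \<otimes> h \<otimes> inv h') \<otimes> inv (x j)"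
      using hH(2) by (simp add: g_eq inv_mult_group m_assoc)
    then have "\<phi> i (g \<otimes> h \<otimes> inv g) = \<phi> k h' \<otimes> \<phi> k h \<otimes> inv (\<phi> k h')"
      using k h' hH(1) by (simp add: \<phi>_mult \<phi>_inv)
    also have "\<dots> \<in> K n"
      using N.inv_op_closed2[OF \<phi>_closed[OF k(1) h']] h k(1) unfolding K_Suc by blast
    finally show "\<phi> i (g \<otimes> h \<otimes> inv g) \<in> K n" .
  qed
  ultimately show ?case by (simp only: normal_inv_iff) blast
qed

lemma K_incseq: "incseq K"
proof (rule incseq_SucI)
  show "K n \<subseteq> K (Suc n)" for n
  proof (induction n)
    case 0
    show ?case using K_Suc[of \<one> 0] \<phi>_one by auto
  next
    case (Suc n)
    then show ?case using K_Suc by blast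
  qed
qed

lemma K_limit_normal: "K_limit G H r \<phi> \<lhd> G"
proof -
  have K: "subgroup (K n) G" for n using K_normal normal_imp_subgroup by blast
  have "subgroup (K_limit G H r \<phi>) G"
    unfolding K_limit_def
  proof (rule subgroupI)
    show "(\<Union>n. K n) \<subseteq> carrier G" using subgroup.subset[OF K] by blast
    show "(\<Union>n. K n) \<noteq> {}" using subgroup.one_closed[OF K] by blast
  next
    fix g assume "g \<in> (\<Union>n. K n)"
    then show "inv g \<in> (\<Union>n. K n)" using subgroup.m_inv_closed[OF K] by blast
  next
    fix g h assume "g \<in> (\<Union>n. K n)" "h \<in> (\<Union>n. K n)"
    then obtain m n where "g \<in> K m" "h \<in> K n" by blast
    then have "g \<in> K (max m n)" "h \<in> K (max m n)"
      using K_incseq by (meson incseqD max.cobounded1 max.cobounded2 subsetD)+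
    then show "g \<otimes> h \<in> (\<Union>n. K n)" using subgroup.m_closed[OF K] by blast
  qed
  then show ?thesis
    using K_normal by (auto simp: normal_inv_iff K_limit_def)
qed

text \<open>The union is a fixed point of the recursion because there are only finitely many
  \<open>\<phi> i\<close>: the levels reached by the images of \<open>h\<close> have a
  maximum.\<close>

lemma K_limit_iff:
  "h \<in> K_limit G H r \<phi> \<longleftrightarrow> h \<in> H \<and> (\<forall>i\<in>{1..r}. \<phi> i h \<in> K_limit G H r \<phi>)"
proof
  assume "h \<in> K_limit G H r \<phi>"
  then obtain n where "h \<in> K n" by (auto simp: K_limit_def)
  then have "h \<in> K (Suc n)" using K_incseq incseq_SucD by blast
  then show "h \<in> H \<and> (\<forall>i\<in>{1..r}. \<phi> i h \<in> K_limit G H r \<phi>)"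
    unfolding K_Suc K_limit_def by blast
next
  assume h: "h \<in> H \<and> (\<forall>i\<in>{1..r}. \<phi> i h \<in> K_limit G H r \<phi>)"
  then have "\<forall>i\<in>{1..r}. \<exists>n. \<phi> i h \<in> K n"
    by (simp add: K_limit_def)
  from bchoice[OF this] obtain n where n: "\<And>i. i \<in> {1..r} \<Longrightarrow> \<phi> i h \<in> K (n i)"
    by blast
  have "\<phi> i h \<in> K (Max (n ` {1..r}))" if "i \<in> {1..r}" for i
    using n[OF that] K_incseq that by (meson Max_ge finite_atLeastAtMost finite_imageI image_eqI incseqD subsetD)
  then have "h \<in> K (Suc (Max (n ` {1..r})))" using h K_Suc by blast
  then show "h \<in> K_limit G H r \<phi>" unfolding K_limit_def by blast
qed

text \<open>Each application of \<open>\<phi> i\<close> lowers the level of the normal closure of \<open>B\<close> by one, but covers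
  \<open>B\<close> again.\<close>

lemma trivial_if_covered_by_normal_closure:
  assumes "B \<subseteq> K n" "i \<in> {1..r}" "B \<subseteq> \<phi> i ` (H \<inter> normal_closure G B)"
  shows "B \<subseteq> {\<one>}"
  using assms(1)
proof (induction n)
  case (Suc n)
  have "normal_closure G B \<subseteq> K (Suc n)"
    by (rule normal_closure_minimal[OF K_normal Suc.prems])
  then have "\<phi> i ` (H \<inter> normal_closure G B) \<subseteq> K n"
    using assms(2) K_Suc by blast
  with assms(3) Suc.IH show ?case by blast
qed simp

end

section \<open>Dense relatedness of the quotient\<close>

theorem theorem4p15:
  fixes G :: "('a, 'b) monoid_scheme" (structure)
    and T :: "'a topology"
    and H :: "'a set"
    and r :: nat
    and x :: "nat \<Rightarrow> 'a"
    and \<phi> :: "nat \<Rightarrow> 'a \<Rightarrow> 'a"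
  assumes "locally_compact_group G T"
    and "compactly_generated G T"
    and "H \<lhd> G"
    and "closedin T H"
    and "finite (rcosets H)" and "card (rcosets H) = r"
    and "\<And>i. i \<in> {1..r} \<Longrightarrow> x i \<in> carrier G"
    and "carrier G = (\<Union>i\<in>{1..r}. x i <# H)"
    and "\<And>i. i \<in> {1..r} \<Longrightarrow> \<phi> i \<in> epi (G\<lparr>carrier := H\<rparr>) G"
    and "\<And>i. i \<in> {1..r} \<Longrightarrow> continuous_map (subtopology T H) T (\<phi> i)"
    and "(\<Inter>i\<in>{1..r}. kernel (G\<lparr>carrier := H\<rparr>) G (\<phi> i)) \<noteq> {\<one>}"
    and "\<forall>i\<in>{1..r}. \<forall>j\<in>{1..r}. \<exists>k\<in>{1..r}. \<forall>h\<in>H. \<phi> i (x j \<otimes> h \<otimes> inv (x j)) = \<phi> k h"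
    and "(\<lambda>g. \<lambda>i\<in>{1..r}. g) ` carrier G \<subseteq> (\<lambda>h. \<lambda>i\<in>{1..r}. \<phi> i h) ` H"
    and "closedin T (K_limit G H r \<phi>)"
  shows "densely_related (G Mod K_limit G H r \<phi>)
           (quotient_group_topology G T (K_limit G H r \<phi>))"
proof -
  interpret locally_compact_group G T by fact
  have "r \<noteq> 0"
  proof
    assume "r = 0"
    then have "carrier G = {}" using assms(8) by simp
    then show False using one_closed by blast
  qed
  then have one_r: "1 \<in> {1..r}" by simp
  interpret finite_index_epimorphisms H G r x \<phi>
    using assms(3,7,8,9,12) \<open>r \<noteq> 0\<close>
    by (intro finite_index_epimorphisms.intro finite_index_epimorphisms_axioms.intro) auto
  let ?K = "K_limit G H r \<phi>"
  have K_mem: "K n \<subseteq> ?K" for n by (auto simp: K_limit_def)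
  have K_le: "?K \<subseteq> H" using K_limit_iff by blast
  have K_carrier: "?K \<subseteq> carrier G" using K_le subset by blast
  obtain S where S: "compact_generating_set G T S" "\<one> \<in> S" "\<And>s. s \<in> S \<Longrightarrow> inv s \<in> S"
    using symmetric_compact_generating_set[OF assms(2)] by blast
  then have SG: "S \<subseteq> carrier G" "compactin T S" "generate G S = carrier G"
    using topspace_eq compactin_subset_topspace[of T S] by (auto simp: compact_generating_set_def)
  let ?B = "\<lambda>n. ?K \<inter> word_ball G S n"

  \<comment> \<open>The preimage of the diagonal of \<open>G^r\<close>; hypothesis (3) makes
    \<open>\<phi> 1\<close> map it onto \<open>G\<close>.\<close>
  define D where "D = {h \<in> H. \<forall>i\<in>{1..r}. \<phi> i h = \<phi> 1 h}"
  have DI: "h \<in> D" if "h \<in> H" "\<And>i. i \<in> {1..r} \<Longrightarrow> \<phi> i h = \<phi> 1 h" for h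
    unfolding D_def using that by blast
  have D_le: "D \<subseteq> H" and D_eq: "\<And>h i. h \<in> D \<Longrightarrow> i \<in> {1..r} \<Longrightarrow> \<phi> i h = \<phi> 1 h"
    unfolding D_def by blast+
  have D_subgroup: "subgroup D G"
  proof (rule subgroupI)
    show "D \<subseteq> carrier G" using subset D_le by blast
    have "\<one> \<in> D" using \<phi>_one one_r by (intro DI) simp_all
    then show "D \<noteq> {}" by blast
  next
    fix g assume "g \<in> D"
    then show "inv g \<in> D"
      using D_le D_eq[of g] \<phi>_inv one_r m_inv_closed by (intro DI) (metis subsetD)+
  next
    fix g h assume "g \<in> D" "h \<in> D"
    then show "g \<otimes> h \<in> D"
      using D_le D_eq[of g] D_eq[of h] \<phi>_mult one_r m_closed by (intro DI) (metis subsetD)+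
  qed
  have D_closed: "closedin T D"
  proof -
    let ?X = "subtopology T H"
    have "D = (\<Inter>i\<in>{1..r}. {h \<in> topspace ?X. \<phi> i h = \<phi> 1 h})"
      using one_r subset topspace_eq unfolding D_def topspace_subtopology by blast
    moreover have "closedin ?X (\<Inter>i\<in>{1..r}. {h \<in> topspace ?X. \<phi> i h = \<phi> 1 h})"
      using one_r by (intro closedin_INT closedin_continuous_maps_eq[OF Hausdorff] assms(10)) auto
    ultimately show ?thesis using closedin_trans_full[OF _ assms(4)] by simp
  qed
  have "\<phi> 1 ` D = carrier G"
  proof (intro subset_antisym subsetI)
    fix g assume "g \<in> carrier G"
    then obtain h where h: "h \<in> H" "(\<lambda>i\<in>{1..r}. g) = (\<lambda>i\<in>{1..r}. \<phi> i h)"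
      using assms(13) by blast
    then have "\<phi> i h = g" if "i \<in> {1..r}" for i
      using h(2) that by (metis restrict_apply')
    then have "h \<in> D" "g = \<phi> 1 h" using h(1) one_r DI[of h] by metis+
    then show "g \<in> \<phi> 1 ` D" by blast
  next
    fix g assume "g \<in> \<phi> 1 ` D"
    then show "g \<in> carrier G" using \<phi>_closed[OF one_r] D_le by blast
  qed
  moreover have "\<phi> 1 \<in> hom (G\<lparr>carrier := D\<rparr>) G"
    using \<phi>_closed[OF one_r] \<phi>_mult[OF one_r] D_le by (simp add: hom_def subset_iff)
  moreover have "continuous_map (subtopology T D) T (\<phi> 1)"
    using continuous_map_from_subtopology_mono[OF assms(10)[OF one_r] D_le] .
  ultimately obtain L where "word_ball G S m \<subseteq> \<phi> 1 ` (D \<inter> word_ball G S (L * m))" for m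
    using bounded_lifts[OF S D_subgroup D_closed] by blast
  then have lift: "?B m \<subseteq> \<phi> 1 ` ?B (L * m)" for m
  proof -
    assume *: "\<And>m. word_ball G S m \<subseteq> \<phi> 1 ` (D \<inter> word_ball G S (L * m))"
    show "?B m \<subseteq> \<phi> 1 ` ?B (L * m)"
    proof
      fix g assume g: "g \<in> ?B m"
      \<comment> \<open>Taking the lift in \<open>D\<close> gives \<open>\<phi> i h = g\<close> for
        every \<open>i\<close>, so \<open>K_limit_iff\<close> puts \<open>h\<close> in
        \<open>?K\<close>; a lift under \<open>\<phi> 1\<close> alone would not ensure this.\<close>
      then obtain h where h: "h \<in> D" "h \<in> word_ball G S (L * m)" "g = \<phi> 1 h" using * by blast
      then have "\<phi> i h \<in> ?K" if "i \<in> {1..r}" for i using g D_eq[OF _ that] by simp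
      then have "h \<in> ?K" using h(1) D_le K_limit_iff[of h] by blast
      with h show "g \<in> \<phi> 1 ` ?B (L * m)" by blast
    qed
  qed

  \<comment> \<open>A nontrivial element of the common kernel lies in \<open>K 1\<close>;
    \<open>n0\<close> is a radius at which it appears.\<close>
  obtain n0 where n0: "\<not> ?B n0 \<subseteq> {\<one>}"
  proof -
    let ?I = "\<Inter>i\<in>{1..r}. kernel (G\<lparr>carrier := H\<rparr>) G (\<phi> i)"
    have "\<one> \<in> ?I" using \<phi>_one by (auto simp: kernel_def)
    then obtain g where g: "g \<in> ?I" "g \<noteq> \<one>" using assms(11) by blast
    then have "g \<in> K 1" using K_Suc[of g 0] one_r by (auto simp: kernel_def)
    then have "g \<in> ?K" using K_mem by blast
    moreover from this obtain n where "g \<in> word_ball G S n"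
      using Union_word_ball[OF SG(3) S(3)] K_carrier by blast
    ultimately show ?thesis using that g(2) by blast
  qed

  have K_closed: "closedin T (K n)" for n
  proof (induction n)
    case 0
    show ?case using closedin_Hausdorff_singleton[OF Hausdorff] topspace_eq by simp
  next
    case (Suc n)
    let ?X = "subtopology T H"
    have "K (Suc n) = (\<Inter>i\<in>{1..r}. {h \<in> topspace ?X. \<phi> i h \<in> K n})"
      using subset topspace_eq by auto
    moreover have "closedin ?X (\<Inter>i\<in>{1..r}. {h \<in> topspace ?X. \<phi> i h \<in> K n})"
      using one_r Suc.IH by (intro closedin_INT closedin_continuous_map_preimage[OF assms(10)]) auto
    ultimately show ?case using closedin_trans_full[OF _ assms(4)] by metis
  qed
  \<comment> \<open>The exhaustion lemma now works in \<open>?K\<close>, with the closed subgroups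
    \<open>K n\<close> as the sets \<open>A n\<close>.\<close>
  have trapped: "\<exists>n. ?B m \<subseteq> K n" for m
  proof (rule compactin_subset_exhaustion)
    show "subgroup ?K G" by (rule normal_imp_subgroup[OF K_limit_normal])
    show "compactin T (?B m)"
      by (rule closed_Int_compactin[OF assms(14) compactin_word_ball[OF SG(2)]])
    show "g \<otimes> h \<in> K (m + n)" if "g \<in> K m" "h \<in> K n" for m n g h
    proof -
      have "g \<in> K (m + n)" "h \<in> K (m + n)"
        using that incseqD[OF K_incseq, of m "m + n"] incseqD[OF K_incseq, of n "m + n"] by auto
      then show ?thesis using subgroup.m_closed[OF normal_imp_subgroup[OF K_normal]] by blast
    qed
  qed (use assms(14) K_closed K_incseq in \<open>auto simp: K_limit_def\<close>)

  \<comment> \<open>The bound \<open>n0 \<le> m\<close> keeps \<open>?B m\<close> nontrivial, as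
    word balls increase.\<close>
  have new_relation: "\<not> ?B (L * m) \<subseteq> normal_closure G (?B m)" if "n0 \<le> m" for m
  proof
    assume "?B (L * m) \<subseteq> normal_closure G (?B m)"
    then have "?B m \<subseteq> \<phi> 1 ` (H \<inter> normal_closure G (?B m))"
      using lift[of m] K_le by blast
    moreover obtain n where "?B m \<subseteq> K n" using trapped by blast
    ultimately have "?B m \<subseteq> {\<one>}"
      using trivial_if_covered_by_normal_closure one_r by blast
    then show False using n0 word_ball_mono[OF SG(1) S(2) that] by blast
  qed

  let ?S = "(\<lambda>g. ?K #> g) ` S"
  \<comment> \<open>The 2 meets the lower bound in \<open>relation_range_FactGroup\<close>, and
    \<open>n0\<close> the one in \<open>new_relation\<close>.\<close>
  define N where "N = max 2 n0"
  \<comment> \<open>The relation is sought between \<open>N * n\<close> and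
    \<open>max 1 L * (N * n)\<close>; replacing \<open>L\<close> by \<open>max 1 L\<close> keeps the
    endpoints in order and the constant positive even if \<open>L = 0\<close>.\<close>
  have "\<exists>k\<in>relation_range (G Mod ?K) ?S. real n \<le> real k \<and> real k \<le> real (max 1 L * N) * real n"
    if "1 \<le> n" for n
  proof -
    have "\<not> ?B (max 1 L * (N * n)) \<subseteq> normal_closure G (?B (N * n))"
    proof -
      have "N * 1 \<le> N * n" using that by (intro mult_le_mono) auto
      then have "n0 \<le> N * n" by (simp add: N_def)
      moreover have "?B (L * (N * n)) \<subseteq> ?B (max 1 L * (N * n))"
        using word_ball_mono[OF SG(1) S(2), of "L * (N * n)" "max 1 L * (N * n)"] by auto
      ultimately show ?thesis using new_relation[of "N * n"] by blast
    qed
    moreover have "2 * 1 \<le> N * n" using that by (intro mult_le_mono) (auto simp: N_def)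
    moreover have "1 * (N * n) \<le> max 1 L * (N * n)" by (intro mult_le_mono) auto
    ultimately obtain k where k: "k \<in> relation_range (G Mod ?K) ?S" "N * n < k" "k \<le> max 1 L * (N * n)"
      using normal.relation_range_FactGroup[OF K_limit_normal SG(1) S(2,3), of "N * n" "max 1 L * (N * n)"]
      by auto
    have "1 * n \<le> N * n" by (intro mult_le_mono) (auto simp: N_def)
    then have "n \<le> k" using k(2) by linarith
    moreover have "real k \<le> real (max 1 L * (N * n))" using k(3) by (simp only: of_nat_le_iff)
    ultimately show ?thesis by (intro bexI[OF _ k(1)]) (simp add: mult.assoc)
  qed
  moreover have "0 < real (max 1 L * N)" by (simp add: N_def)
  ultimately show ?thesis
    unfolding densely_related_def
    using locally_compact_group_quotient[OF K_limit_normal assms(14)]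
      compact_generating_set_quotient[OF K_limit_normal S(1)] by blast
qed

end
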